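(* Let $\Omega\subset\mathbb{R}^N$ be a nonempty open connected set with Lipschitz boundary (the case $\Omega=\mathbb{R}^N$ included). Then the set function $\mu$ is not additive on $\mathcal{E}$: there exist disjoint sets $A,B\in\mathcal{E}$ with $A\cup B\in\mathcal{E}$ and $\mu(A\cup B)\neq\mu(A)+\mu(B)$.
   Context: $N\in\mathbb{N}$, $N\ge 1$. $\gamma$ denotes the standard Gaussian probability measure on $\mathbb{R}^N$, $d\gamma(x)=(2\pi)^{-N/2}e^{-|x|^2/2}\,dx$. "Measurable" means Lebesgue measurable and $A^c=\mathbb{R}^N\setminus A$. For $t>0$ and $x,y\in\mathbb{R}^N$ the Mehler kernel is $$M_t(x,y):=\frac{1}{(1-e^{-2t})^{N/2}}\exp\left(-\frac{e^{-2t}|x|^2-2e^{-t}x\cdot y+e^{-2t}|y|^2}{2(1-e^{-2t})}\right),$$ and for $\sigma>0$ $$K_\sigma(x,y):=\int_0^\infty\frac{M_t(x,y)}{t^{\frac{\sigma}{2}+1}}\,dt.$$ For $s\in(0,1)$ and a measurable set $E\subset\mathbb{R}^N$, the fractional Gaussian $s$-perimeter of $E$ in $\Omega$ is the (possibly infinite) quantity $$P^\gamma_s(E;\Omega):=\int_{E\cap\Omega}d\gamma(x)\int_{E^c\cap\Omega}K_s(x,y)\,d\gamma(y)+\int_{E\cap\Omega}d\gamma(x)\int_{E^c\cap\Omega^c}K_s(x,y)\,d\gamma(y)+\int_{E\cap\Omega^c}d\gamma(x)\int_{E^c\cap\Omega}K_s(x,y)\,d\gamma(y).$$ $\mathcal{E}$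 is the family of all measurable sets $E\subset\mathbb{R}^N$ for which there exists $s_0\in(0,1)$ with $P^\gamma_{s_0}(E;\Omega)<\infty$. For $E\in\mathcal{E}$ the limit $$\mu(E):=\lim_{s\to 0^+}sP^\gamma_s(E;\Omega)$$ exists, and this defines $\mu$ on $\mathcal{E}$. *)

theory Defs
  imports "HOL-Analysis.Analysis"
begin

definition gaussian_measure :: "(real ^ 'n) measure" where
  "gaussian_measure = density lebesgue
     (\<lambda>x. ennreal ((2 * pi) powr (- (real CARD('n) / 2)) * exp (- (norm x)\<^sup>2 / 2)))"

definition mehler_kernel :: "real \<Rightarrow> real ^ 'n \<Rightarrow> real ^ 'n \<Rightarrow> real" where
  "mehler_kernel t x y =
     1 / (1 - exp (- 2 * t)) powr (real CARD('n) / 2) *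
     exp (- (exp (- 2 * t) * (norm x)\<^sup>2 - 2 * exp (- t) * (x \<bullet> y) + exp (- 2 * t) * (norm y)\<^sup>2)
          / (2 * (1 - exp (- 2 * t))))"

text \<open>The kernel takes values in \<open>[0, \<infinity>]\<close>: for \<open>\<sigma> > 0\<close> it is infinite on the diagonal.\<close>

definition frac_kernel :: "real \<Rightarrow> real ^ 'n \<Rightarrow> real ^ 'n \<Rightarrow> ennreal" where
  "frac_kernel \<sigma> x y =
     (\<integral>\<^sup>+ t\<in>{0<..}. ennreal (mehler_kernel t x y / t powr (\<sigma> / 2 + 1)) \<partial>lborel)"

definition frac_interaction :: "real \<Rightarrow> (real ^ 'n) set \<Rightarrow> (real ^ 'n) set \<Rightarrow> ennreal" where
  "frac_interaction s A B =
     (\<integral>\<^sup>+ x\<in>A. (\<integral>\<^sup>+ y\<in>B. frac_kernel s x y \<partial>gaussian_measure) \<partial>gaussian_measure)"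

definition frac_perimeter :: "real \<Rightarrow> (real ^ 'n) set \<Rightarrow> (real ^ 'n) set \<Rightarrow> ennreal" where
  "frac_perimeter s E \<Omega> =
     frac_interaction s (E \<inter> \<Omega>) (- E \<inter> \<Omega>) +
     frac_interaction s (E \<inter> \<Omega>) (- E \<inter> - \<Omega>) +
     frac_interaction s (E \<inter> - \<Omega>) (- E \<inter> \<Omega>)"

definition finite_perimeter_sets :: "(real ^ 'n) set \<Rightarrow> (real ^ 'n) set set" where
  "finite_perimeter_sets \<Omega> =
     {E. E \<in> sets lebesgue \<and> (\<exists>s\<^sub>0. 0 < s\<^sub>0 \<and> s\<^sub>0 < 1 \<and> frac_perimeter s\<^sub>0 E \<Omega> < \<infinity>)}"

definition limit_perimeter :: "(real ^ 'n) set \<Rightarrow> (real ^ 'n) set \<Rightarrow> ennreal" where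
  "limit_perimeter \<Omega> E = Lim (at_right 0) (\<lambda>s. ennreal s * frac_perimeter s E \<Omega>)"

text \<open>Near each boundary point, and up to a rotation, \<open>\<Omega>\<close> is the strict epigraph of a Lipschitz
  function: \<open>v\<close> is the vertical direction, \<open>\<phi>\<close> is a function on the hyperplane orthogonal to \<open>v\<close>,
  and \<open>x - (x \<bullet> v) *\<^sub>R v\<close> is the horizontal part of \<open>x\<close>. No uniformity of \<open>r\<close> and \<open>L\<close> along the
  boundary is required.\<close>

definition lipschitz_boundary :: "(real ^ 'n) set \<Rightarrow> bool" where
  "lipschitz_boundary \<Omega> \<longleftrightarrow>
     (\<forall>p\<in>frontier \<Omega>. \<exists>r>0. \<exists>v. \<exists>\<phi>. \<exists>L. norm v = 1 \<and> L-lipschitz_on {z. z \<bullet> v = 0} \<phi> \<and>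
        \<Omega> \<inter> ball p r = {x \<in> ball p r. \<phi> (x - (x \<bullet> v) *\<^sub>R v) < x \<bullet> v})"

end

theory Submission
  imports Defs "HOL-Probability.Distributions"
begin

text \<open>
  Since \<open>M\<^sub>t \<rightarrow> 1\<close> as \<open>t \<rightarrow> \<infinity>\<close>, the mass of \<open>s K\<^sub>s\<close> moves to large times as \<open>s \<rightarrow> 0\<close>, and \<open>s K\<^sub>s\<close>
  tends to \<open>2\<close> off the diagonal. Hence \<open>\<mu>(E)\<close> is a sum of products of Gaussian measures of parts
  of \<open>E\<close> and of its complement. Such an expression vanishes on the whole space but is positive on
  a ball \<open>U\<close> centred in \<open>\<Omega>\<close>, because \<open>U \<inter> \<Omega>\<close> and the complement of \<open>U\<close> both have positive measure.
  So \<open>A = U\<close> and \<open>B = - U\<close> violate additivity: \<open>\<mu>(A \<union> B) = 0\<close> while \<open>\<mu>(A) > 0\<close>.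

  What has to be proved is that the unit ball has finite perimeter and that its limit exists and is
  the expected one. The perimeter is at most the interaction of the ball with its complement.
  By Tonelli (\<open>frac_interaction_eq\<close>) an interaction of \<open>A\<close> and \<open>B\<close> is the integral
  over \<open>t > 0\<close> of \<open>t\<^bsup>-s/2-1\<^esup>\<close> times the overlap \<open>\<integral>\<^sub>A \<integral>\<^sub>B M\<^sub>t d\<gamma> d\<gamma>\<close>. Two facts about overlaps
  suffice: for subsets of the ball and of its complement the overlap is \<open>O(sqrt (1 - exp (- t)))\<close>
  (\<open>mehler_overlap_ball_le\<close>), and for all Borel sets it tends to \<open>\<gamma>(A) \<gamma>(B)\<close> as \<open>t \<rightarrow> \<infinity>\<close>
  (\<open>mehler_overlap_tendsto\<close>). An Abelian argument in the single variable \<open>t\<close>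
  (\<open>power_weighted_integral_near_zero\<close>) turns them into finiteness for \<open>0 < s < 1\<close> and the
  limit \<open>2 \<gamma>(A) \<gamma>(B)\<close>.
\<close>

section \<open>Power weights concentrating at infinity\<close>

lemma has_bochner_integral_has_integral_nonneg:
  fixes f :: "'a::euclidean_space \<Rightarrow> real"
  assumes [measurable]: "f \<in> borel_measurable borel" "S \<in> sets borel"
    and "\<And>x. x \<in> S \<Longrightarrow> 0 \<le> f x" and "(f has_integral I) S"
  shows "has_bochner_integral lborel (\<lambda>x. indicator S x * f x) I"
proof (rule has_bochner_integral_nn_integral)
  show "(\<integral>\<^sup>+ x. ennreal (indicator S x * f x) \<partial>lborel) = ennreal I"
    using nn_integral_has_integral_lebesgue[of S f I] assms by simp
  show "0 \<le> I"
    using has_integral_nonneg[OF assms(4)] assms(3) by simp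
qed (use assms(3) in \<open>auto simp: indicator_def\<close>)

text \<open>As \<open>s \<rightarrow> 0\<close> the weights \<open>s t\<^bsup>-s/2-1\<^esup>\<close> on \<open>[1, \<infinity>)\<close> have constant mass \<open>2\<close>, and this mass escapes to
  infinity because the weights are at most \<open>s\<close> there; so they average a bounded function to twice
  its limit at infinity. Near \<open>t = 0\<close> the decay \<open>h t \<le> C sqrt t\<close> keeps the integral bounded, and
  the prefactor \<open>s\<close> removes it. Both parts come out of one comparison of the integrand with
  \<open>L t\<^bsup>-s/2-1\<^esup>\<close> on \<open>[1, \<infinity>)\<close>.\<close>

lemma power_weighted_integral_near_zero:
  fixes h :: "real \<Rightarrow> real"
  assumes [measurable]: "h \<in> borel_measurable borel"
    and nonneg: "\<And>t. 0 \<le> h t"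
    and bound: "\<And>t. t > 0 \<Longrightarrow> h t \<le> C" "\<And>t. t > 0 \<Longrightarrow> h t \<le> C * sqrt t"
    and lim: "(h \<longlongrightarrow> L) at_top"
  shows "\<And>s. 0 < s \<Longrightarrow> s < 1 \<Longrightarrow>
           integrable lborel (\<lambda>t. indicator {0<..} t * (h t / t powr (s/2 + 1)))"
    and "((\<lambda>s. s * (\<integral>t. indicator {0<..} t * (h t / t powr (s/2 + 1)) \<partial>lborel)) \<longlongrightarrow> 2 * L)
           (at_right 0)"
proof -
  \<comment> \<open>\<open>L * p s\<close> is the comparison function for \<open>f s\<close>; \<open>C * q s\<close> dominates \<open>f s\<close> on \<open>(0, 1]\<close>.\<close>
  define f where "f s t = indicator {0<..} t * (h t / t powr (s/2 + 1))" for s t :: real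
  define p where "p s t = indicator {1..} t * t powr (- s/2 - 1)" for s t :: real
  define q where "q s t = indicator {0..1} t * t powr (- s/2 - 1/2)" for s t :: real
  define K where "K = C + \<bar>L\<bar>"
  have [measurable]: "f s \<in> borel_measurable borel" for s
    unfolding f_def by measurable
  have C: "0 \<le> C" using bound(1)[of 1] nonneg[of 1] by linarith
  have p: "has_bochner_integral lborel (p s) (2/s)" if "s > 0" for s
  proof -
    have "((\<lambda>t. t powr (- s/2 - 1)) has_integral 2/s) {1..}"
      using has_integral_powr_to_inf[of "- s/2 - 1" 1] that by simp
    then show ?thesis
      unfolding p_def by (intro has_bochner_integral_has_integral_nonneg) auto
  qed
  have q: "has_bochner_integral lborel (q s) (2/(1-s))" if "s < 1" for s
  proof -
    have "((\<lambda>t. t powr (- s/2 - 1/2)) has_integral 2/(1-s)) {0..1}"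
      using has_integral_powr_from_0[of "- s/2 - 1/2" 1] that by (simp add: field_simps)
    then show ?thesis
      unfolding q_def by (intro has_bochner_integral_has_integral_nonneg) auto
  qed
  have r: "has_bochner_integral lborel (indicator {1..T}) (T - 1)" if "T \<ge> 1" for T :: real
    using has_bochner_integral_real_indicator[of "{1..T}" lborel] that by simp
  have pointwise: "\<bar>f s t - L * p s t\<bar> \<le> C * q s t + K * indicator {1..T} t + \<epsilon> * p s t"
    if "0 < s" "T \<ge> 1" "\<epsilon> \<ge> 0" and T: "\<And>t. t \<ge> T \<Longrightarrow> \<bar>h t - L\<bar> \<le> \<epsilon>" for s T \<epsilon> t
  proof -
    have minus1: "t powr (- s/2 - 1) = 1 / t powr (s/2 + 1)"
      using powr_minus_divide[of t "s/2 + 1"] by simp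
    consider "t \<le> 0" | "0 < t" "t < 1" | "1 \<le> t" by linarith
    then show ?thesis
    proof cases
      case 1
      then show ?thesis by (simp add: f_def p_def q_def indicator_def)
    next
      case 2
      have exponent: "1/2 + (- s/2 - 1) = - s/2 - 1/2" by simp
      have "f s t = h t * t powr (- s/2 - 1)"
        unfolding f_def minus1 using 2 by simp
      also have "\<dots> \<le> (C * sqrt t) * t powr (- s/2 - 1)"
        using bound(2) 2 by (intro mult_right_mono) auto
      also have "\<dots> = C * (t powr (1/2) * t powr (- s/2 - 1))"
        using 2 by (simp add: powr_half_sqrt)
      also have "\<dots> = C * q s t"
        unfolding powr_add[symmetric] q_def exponent using 2 by simp
      finally have "f s t \<le> C * q s t" .
      moreover have "0 \<le> f s t" using nonneg by (simp add: f_def)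
      ultimately show ?thesis using 2 by (simp add: p_def)
    next
      case 3
      have eq: "f s t - L * p s t = (h t - L) * p s t"
        unfolding f_def p_def minus1 using 3 by (simp add: diff_divide_distrib)
      have p01: "0 \<le> p s t" "p s t \<le> 1"
        using 3 \<open>0 < s\<close> powr_mono[of "- s/2 - 1" 0 t] by (auto simp: p_def)
      have q0: "0 \<le> C * q s t" using C by (simp add: q_def)
      have "\<bar>f s t - L * p s t\<bar> = \<bar>h t - L\<bar> * p s t"
        using p01 by (simp add: eq abs_mult)
      also have "\<dots> \<le> K * indicator {1..T} t + \<epsilon> * p s t"
      proof (cases "t \<le> T")
        case True
        have hK: "\<bar>h t - L\<bar> \<le> K"
          using bound(1)[of t] nonneg[of t] 3 by (simp add: K_def)
        then have "\<bar>h t - L\<bar> * p s t \<le> K * 1"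
          using p01 by (intro mult_mono) auto
        moreover have "0 \<le> \<epsilon> * p s t" using p01 \<open>\<epsilon> \<ge> 0\<close> by simp
        ultimately show ?thesis using True 3 by simp
      next
        case False
        then have "\<bar>h t - L\<bar> * p s t \<le> \<epsilon> * p s t"
          using T[of t] p01 by (intro mult_right_mono) auto
        with False show ?thesis by simp
      qed
      finally show ?thesis using q0 by simp
    qed
  qed
  have main: "integrable lborel (f s) \<and>
      \<bar>s * (\<integral>t. f s t \<partial>lborel) - 2 * L\<bar> \<le> s * (C * (2/(1-s)) + K * (T - 1)) + 2 * \<epsilon>"
    if s: "0 < s" "s < 1" and T: "T \<ge> 1" "\<epsilon> \<ge> 0" "\<And>t. t \<ge> T \<Longrightarrow> \<bar>h t - L\<bar> \<le> \<epsilon>" for s T \<epsilon>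
  proof -
    have w: "has_bochner_integral lborel (\<lambda>t. C * q s t + K * indicator {1..T} t + \<epsilon> * p s t)
        (C * (2/(1-s)) + K * (T - 1) + \<epsilon> * (2/s))"
      using p[OF s(1)] q[OF s(2)] r[OF T(1)]
      by (intro has_bochner_integral_add has_bochner_integral_mult_right) auto
    note Lp = has_bochner_integral_mult_right[OF p[OF s(1)], of L]
    have pm [measurable]: "p s \<in> borel_measurable borel"
      unfolding p_def by measurable
    have d: "integrable lborel (\<lambda>t. f s t - L * p s t)"
      by (rule Bochner_Integration.integrable_bound[OF w[unfolded has_bochner_integral_iff, THEN conjunct1]])
         (use pointwise[OF s(1) T] in \<open>auto intro!: AE_I2 order.trans[OF _ abs_ge_self]\<close>)
    have "integrable lborel (\<lambda>t. (f s t - L * p s t) + L * p s t)"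
      using d Lp by (intro Bochner_Integration.integrable_add) (auto simp: has_bochner_integral_iff)
    then have f: "integrable lborel (f s)" by simp
    have "\<bar>\<integral>t. f s t - L * p s t \<partial>lborel\<bar> \<le> (\<integral>t. C * q s t + K * indicator {1..T} t + \<epsilon> * p s t \<partial>lborel)"
      by (rule Bochner_Integration.integral_abs_bound_integral)
         (use pointwise[OF s(1) T] d w in \<open>auto simp: has_bochner_integral_iff\<close>)
    also have "\<dots> = C * (2/(1-s)) + K * (T - 1) + \<epsilon> * (2/s)"
      using w by (simp add: has_bochner_integral_iff)
    also have "(\<integral>t. f s t - L * p s t \<partial>lborel) = (\<integral>t. f s t \<partial>lborel) - L * (2/s)"
      using f Lp by (subst Bochner_Integration.integral_diff) (auto simp: has_bochner_integral_iff)
    finally have "s * \<bar>(\<integral>t. f s t \<partial>lborel) - L * (2/s)\<bar>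
        \<le> s * (C * (2/(1-s)) + K * (T - 1) + \<epsilon> * (2/s))"
      using s by (intro mult_left_mono) auto
    moreover have "s * \<bar>(\<integral>t. f s t \<partial>lborel) - L * (2/s)\<bar> = \<bar>s * ((\<integral>t. f s t \<partial>lborel) - L * (2/s))\<bar>"
      using s by (simp add: abs_mult)
    moreover have "s * ((\<integral>t. f s t \<partial>lborel) - L * (2/s)) = s * (\<integral>t. f s t \<partial>lborel) - 2 * L"
      using s by (simp add: right_diff_distrib)
    moreover have "s * (C * (2/(1-s)) + K * (T - 1) + \<epsilon> * (2/s))
        = s * (C * (2/(1-s)) + K * (T - 1)) + 2 * \<epsilon>"
      using s by (simp add: distrib_left)
    ultimately show ?thesis using f by simp
  qed
  have ex: "\<exists>T\<ge>1. \<forall>t\<ge>T. \<bar>h t - L\<bar> \<le> \<epsilon>" if "\<epsilon> > 0" for \<epsilon>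
  proof -
    have "\<forall>\<^sub>F t in at_top. dist (h t) L < \<epsilon>" using lim that by (simp add: tendstoD)
    then obtain T where "\<And>t. t \<ge> T \<Longrightarrow> dist (h t) L < \<epsilon>"
      by (auto simp: eventually_at_top_linorder)
    then show ?thesis
      by (intro exI[of _ "max 1 T"]) (auto simp: dist_real_def intro: less_imp_le)
  qed
  show "integrable lborel (\<lambda>t. indicator {0<..} t * (h t / t powr (s/2 + 1)))" if "0 < s" "s < 1" for s
    using ex[of 1] main[of s _ 1] that unfolding f_def by auto
  have "((\<lambda>s. s * (\<integral>t. f s t \<partial>lborel)) \<longlongrightarrow> 2 * L) (at_right 0)"
  proof (rule tendstoI)
    fix e :: real assume "e > 0"
    obtain T where T: "T \<ge> 1" "\<And>t. t \<ge> T \<Longrightarrow> \<bar>h t - L\<bar> \<le> e/4"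
      using ex[of "e/4"] \<open>e > 0\<close> by auto
    have "((\<lambda>s::real. s * (C * (2/(1-s)) + K * (T - 1)) + 2 * (e/4)) \<longlongrightarrow>
        0 * (C * (2/(1-0)) + K * (T - 1)) + 2 * (e/4)) (at_right 0)"
      by (intro tendsto_intros) auto
    then have "\<forall>\<^sub>F s in at_right 0. s * (C * (2/(1-s)) + K * (T - 1)) + 2 * (e/4) < e"
      by (rule order_tendstoD) (use \<open>e > 0\<close> in auto)
    moreover have "\<forall>\<^sub>F s in at_right 0. s \<in> {0<..<1::real}"
      by (rule eventually_at_right_real) simp
    ultimately show "\<forall>\<^sub>F s in at_right 0. dist (s * (\<integral>t. f s t \<partial>lborel)) (2 * L) < e"
    proof eventually_elim
      case (elim s)
      then show ?case using main[of s T "e/4"] T \<open>e > 0\<close> by (auto simp: dist_real_def)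
    qed
  qed
  then show "((\<lambda>s. s * (\<integral>t. indicator {0<..} t * (h t / t powr (s/2 + 1)) \<partial>lborel)) \<longlongrightarrow> 2 * L)
           (at_right 0)"
    unfolding f_def .
qed

section \<open>The joint law of the Ornstein--Uhlenbeck process at two times\<close>

text \<open>This is needed in \<open>\<real>\<^sup>N\<close> for the overlap at small times and in \<open>\<real>\<^sup>N \<times> \<real>\<^sup>N\<close> for the domination at
  large times, hence the general Euclidean space.\<close>

lemma nn_integral_exp_neg_norm_sq_finite:
  assumes "c > 0"
  shows "(\<integral>\<^sup>+x. ennreal (exp (- c * (norm (x::'a::euclidean_space))\<^sup>2)) \<partial>lborel) < \<infinity>"
proof -
  have one: "(\<integral>\<^sup>+x. ennreal (exp (- c * (x::real)\<^sup>2)) \<partial>lborel) < \<infinity>"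
  proof -
    define \<sigma> where "\<sigma> = sqrt (1 / (2*c))"
    have \<sigma>: "\<sigma>\<^sup>2 = 1/(2*c)" using assms by (simp add: \<sigma>_def)
    have "(\<lambda>x. sqrt (2 * pi * \<sigma>\<^sup>2) * normal_density 0 \<sigma> x) = (\<lambda>x. exp (- c * x\<^sup>2))"
      using assms by (auto simp: normal_density_def \<sigma>)
    moreover have "integrable lborel (\<lambda>x. sqrt (2 * pi * \<sigma>\<^sup>2) * normal_density 0 \<sigma> x)"
      using assms by (intro integrable_mult_right integrable_normal_density) (simp add: \<sigma>_def)
    ultimately have "integrable lborel (\<lambda>x. exp (- c * x\<^sup>2))" by simp
    then show ?thesis by (simp add: integrable_iff_bounded)
  qed
  have prod: "ennreal (exp (- c * (norm x)\<^sup>2)) = (\<Prod>b\<in>Basis. ennreal (exp (- c * (x \<bullet> b)\<^sup>2)))"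
    for x :: 'a
  proof -
    have "(norm x)\<^sup>2 = (\<Sum>b\<in>Basis. (x \<bullet> b)\<^sup>2)"
      unfolding power2_norm_eq_inner by (subst euclidean_inner) (simp add: power2_eq_square)
    then have "exp (- c * (norm x)\<^sup>2) = exp (\<Sum>b\<in>Basis. - c * (x \<bullet> b)\<^sup>2)"
      by (simp add: sum_distrib_left sum_negf)
    then show ?thesis by (simp add: exp_sum prod_ennreal)
  qed
  have "(\<integral>\<^sup>+x. ennreal (exp (- c * (norm (x::'a))\<^sup>2)) \<partial>lborel)
      = (\<integral>\<^sup>+x. (\<Prod>b\<in>Basis. ennreal (exp (- c * ((x::'a) \<bullet> b)\<^sup>2))) \<partial>lborel)"
    unfolding prod ..
  also have "\<dots> = (\<Prod>b\<in>(Basis::'a set). \<integral>\<^sup>+x. ennreal (exp (- c * (x::real)\<^sup>2)) \<partial>lborel)"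
    by (rule nn_integral_lborel_prod) auto
  also have "\<dots> < \<infinity>" using one by (simp add: power_less_top_ennreal)
  finally show ?thesis .
qed

definition gaussian_density :: "real ^ 'n \<Rightarrow> real" where
  "gaussian_density x = (2 * pi) powr (- (real CARD('n) / 2)) * exp (- (norm x)\<^sup>2 / 2)"

text \<open>The density, with respect to Lebesgue measure on \<open>\<real>\<^sup>N \<times> \<real>\<^sup>N\<close>, of a pair of standard Gaussian
  vectors with correlation \<open>exp (- t)\<close>: the positions of a stationary Ornstein--Uhlenbeck process
  at time \<open>0\<close> and at time \<open>t\<close>.\<close>

definition mehler_density :: "real \<Rightarrow> real ^ 'n \<Rightarrow> real ^ 'n \<Rightarrow> real" where
  "mehler_density t x y = gaussian_density x * gaussian_density y * mehler_kernel t x y"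

text \<open>The probability that this process starts in \<open>A\<close> and is in \<open>B\<close> at time \<open>t\<close>.\<close>

definition mehler_overlap :: "real \<Rightarrow> (real ^ 'n) set \<Rightarrow> (real ^ 'n) set \<Rightarrow> ennreal" where
  "mehler_overlap t A B =
     (\<integral>\<^sup>+ x. \<integral>\<^sup>+ y. ennreal (mehler_density t x y) * indicator (A \<times> B) (x, y) \<partial>lborel \<partial>lborel)"

lemma gaussian_density_pos: "0 < gaussian_density x"
  by (simp add: gaussian_density_def)

lemma gaussian_density_measurable [measurable]: "gaussian_density \<in> borel_measurable borel"
  unfolding gaussian_density_def by measurable

lemma mehler_kernel_nonneg: "0 \<le> mehler_kernel t x y"
  by (simp add: mehler_kernel_def)

lemma mehler_kernel_measurable [measurable (raw)]:
  assumes [measurable]: "f \<in> borel_measurable M" "g \<in> borel_measurable M" "h \<in> borel_measurable M"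
  shows "(\<lambda>z. mehler_kernel (f z) (g z) (h z)) \<in> borel_measurable M"
  unfolding mehler_kernel_def by measurable

lemma mehler_density_nonneg: "0 \<le> mehler_density t x y"
  by (simp add: mehler_density_def mehler_kernel_nonneg gaussian_density_pos less_imp_le)

lemma mehler_density_measurable [measurable (raw)]:
  assumes [measurable]: "f \<in> borel_measurable M" "g \<in> borel_measurable M" "h \<in> borel_measurable M"
  shows "(\<lambda>z. mehler_density (f z) (g z) (h z)) \<in> borel_measurable M"
  unfolding mehler_density_def by measurable

lemma mehler_density_commute: "mehler_density t x y = mehler_density t y x"
  by (simp add: mehler_density_def mehler_kernel_def inner_commute algebra_simps)

lemma nn_integral_gaussian_measure:
  assumes [measurable]: "f \<in> borel_measurable borel"
  shows "(\<integral>\<^sup>+ x. f x \<partial>gaussian_measure) = (\<integral>\<^sup>+ x. ennreal (gaussian_density x) * f x \<partial>lborel)"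
proof -
  have "f \<in> borel_measurable (completion lborel)"
    "(\<lambda>x. ennreal (gaussian_density x)) \<in> borel_measurable (completion lborel)"
    by (auto intro!: measurable_completion)
  then show ?thesis
    unfolding gaussian_measure_def gaussian_density_def[symmetric]
    by (subst nn_integral_density) (auto simp: nn_integral_completion)
qed

lemma emeasure_gaussian_measure:
  assumes "A \<in> sets borel"
  shows "emeasure gaussian_measure A = (\<integral>\<^sup>+ x. ennreal (gaussian_density x) * indicator A x \<partial>lborel)"
proof -
  have "A \<in> sets gaussian_measure"
    using assms by (auto simp: gaussian_measure_def)
  with assms show ?thesis
    using nn_integral_gaussian_measure[of "indicator A"] by simp
qed

lemma emeasure_gaussian_measure_eq_0_iff:
  assumes "A \<in> sets borel"
  shows "emeasure gaussian_measure A = 0 \<longleftrightarrow> emeasure lborel A = 0"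
proof -
  have "emeasure gaussian_measure A = 0 \<longleftrightarrow>
      (AE x in lborel. ennreal (gaussian_density x) * indicator A x = 0)"
    unfolding emeasure_gaussian_measure[OF assms] using assms
    by (subst nn_integral_0_iff_AE) auto
  also have "\<dots> \<longleftrightarrow> (AE x in lborel. x \<notin> A)"
    by (intro AE_cong)
      (auto simp: indicator_def ennreal_eq_0_iff gaussian_density_pos simp flip: not_less)
  also have "\<dots> \<longleftrightarrow> emeasure lborel A = 0"
    using assms by (subst AE_iff_measurable[where N=A]) auto
  finally show ?thesis .
qed

text \<open>The Gaussian pair \<open>(x, y)\<close> with correlation \<open>r = exp (- t)\<close> becomes independent in the coordinates
  \<open>x - y\<close> and \<open>x + y\<close>. In this form the estimates needed later can be read off: for small \<open>t\<close> the first term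
  concentrates the density near the diagonal at scale \<open>sqrt (1 - r)\<close>, and since both denominators
  are at most \<open>8\<close>, the exponential has a Gaussian bound independent of \<open>t\<close>.\<close>

lemma mehler_density_eq:
  fixes x y :: "real ^ 'n"
  assumes "t > 0"
  shows "mehler_density t x y =
    (2 * pi) powr (- real CARD('n)) * (1 - exp (- 2 * t)) powr (- (real CARD('n) / 2)) *
    exp (- ((norm (x - y))\<^sup>2 / (4 * (1 - exp (- t))) + (norm (x + y))\<^sup>2 / (4 * (1 + exp (- t)))))"
proof -
  define r where "r = exp (- t)"
  have r: "0 < r" "r < 1" "exp (- 2 * t) = r\<^sup>2"
    using assms by (auto simp: r_def simp flip: exp_double)
  have s: "(norm x)\<^sup>2 = x \<bullet> x" "(norm y)\<^sup>2 = y \<bullet> y"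
     "(norm (x - y))\<^sup>2 = x \<bullet> x - 2 * (x \<bullet> y) + y \<bullet> y"
     "(norm (x + y))\<^sup>2 = x \<bullet> x + 2 * (x \<bullet> y) + y \<bullet> y"
    unfolding power2_norm_eq_inner by (simp_all add: inner_commute algebra_simps)
  have d: "2 * (1 - r\<^sup>2) = 2 * ((1 - r) * (1 + r))" "1 - r \<noteq> 0" "1 + r \<noteq> 0"
    using r by (auto simp: power2_eq_square algebra_simps)
  have e: "- (x \<bullet> x) / 2 + (- (y \<bullet> y) / 2 +
      - (r\<^sup>2 * (x \<bullet> x) - 2 * r * (x \<bullet> y) + r\<^sup>2 * (y \<bullet> y)) / (2 * (1 - r\<^sup>2)))
    = - ((x \<bullet> x - 2 * (x \<bullet> y) + y \<bullet> y) / (4 * (1 - r)) + (x \<bullet> x + 2 * (x \<bullet> y) + y \<bullet> y) / (4 * (1 + r)))"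
    unfolding d(1) using d(2,3) by (simp add: divide_simps) (simp add: algebra_simps power2_eq_square)
  have c: "(2 * pi) powr (- real CARD('n)) =
      (2 * pi) powr (- (real CARD('n) / 2)) * (2 * pi) powr (- (real CARD('n) / 2))"
    by (simp flip: powr_add)
  show ?thesis
    unfolding mehler_density_def gaussian_density_def mehler_kernel_def r_def[symmetric] r(3) s
      e[symmetric] exp_add c powr_minus_divide[of "1 - r\<^sup>2"]
    by simp
qed

lemma mehler_overlap_eq:
  assumes [measurable]: "A \<in> sets borel" "B \<in> sets borel"
  shows "mehler_overlap t A B =
    (\<integral>\<^sup>+ p. ennreal (mehler_density t (fst p) (snd p)) * indicator (A \<times> B) p \<partial>lborel)"
proof -
  have "(\<lambda>p. ennreal (mehler_density t (fst p) (snd p)) * indicator (A \<times> B) p)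
      \<in> borel_measurable (lborel \<Otimes>\<^sub>M lborel)"
    by measurable
  from lborel.nn_integral_fst[OF this] show ?thesis
    by (simp add: mehler_overlap_def lborel_prod)
qed

lemma mehler_overlap_commute:
  assumes [measurable]: "A \<in> sets borel" "B \<in> sets borel"
  shows "mehler_overlap t A B = mehler_overlap t B A"
proof -
  have "mehler_overlap t A B =
      (\<integral>\<^sup>+ y. \<integral>\<^sup>+ x. ennreal (mehler_density t x y) * indicator (A \<times> B) (x, y) \<partial>lborel \<partial>lborel)"
    unfolding mehler_overlap_def by (rule lborel_pair.Fubini'[symmetric]) measurable
  also have "\<dots> = mehler_overlap t B A"
    unfolding mehler_overlap_def
    by (intro nn_integral_cong) (auto simp: mehler_density_commute indicator_def)
  finally show ?thesis .
qed

lemma mehler_overlap_measurable [measurable]: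
  assumes [measurable]: "A \<in> sets borel" "B \<in> sets borel"
  shows "(\<lambda>t. mehler_overlap t A B) \<in> borel_measurable borel"
  unfolding mehler_overlap_def by measurable

text \<open>By Tonelli the singular kernel disappears: an interaction is a power-weighted integral in time
  of the overlaps, so its behaviour is governed by that of the overlap as \<open>t \<rightarrow> 0\<close> and
  \<open>t \<rightarrow> \<infinity>\<close>.\<close>

lemma frac_interaction_eq:
  assumes [measurable]: "A \<in> sets borel" "B \<in> sets borel"
  shows "frac_interaction s A B =
    (\<integral>\<^sup>+ t\<in>{0<..}. mehler_overlap t A B * ennreal (1 / t powr (s/2 + 1)) \<partial>lborel)"
proof -
  have fm [measurable]: "(\<lambda>z. frac_kernel s (f z) (g z)) \<in> borel_measurable M"
    if [measurable]: "f \<in> borel_measurable M" "g \<in> borel_measurable M"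
    for f g :: "'b \<Rightarrow> real ^ 'n" and M
    unfolding frac_kernel_def by measurable
  let ?w = "\<lambda>t. ennreal (1 / t powr (s/2 + 1)) * indicator {0<..} t"
  let ?m = "\<lambda>t x y. ennreal (mehler_density t x y) * indicator (A \<times> B) (x, y)"
  have k: "ennreal (gaussian_density x) * (ennreal (gaussian_density y) *
      (frac_kernel s x y * indicator B y) * indicator A x) = (\<integral>\<^sup>+ t. ?m t x y * ?w t \<partial>lborel)" for x y
  proof -
    have "ennreal (gaussian_density x) * (ennreal (gaussian_density y) *
        (frac_kernel s x y * indicator B y) * indicator A x) =
        (ennreal (gaussian_density x) * ennreal (gaussian_density y) * indicator (A \<times> B) (x, y)) *
        frac_kernel s x y"
      by (simp add: indicator_times mult_ac)
    also have "\<dots> = (\<integral>\<^sup>+ t. (ennreal (gaussian_density x) * ennreal (gaussian_density y) * indicator (A \<times> B) (x, y)) *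
        (ennreal (mehler_kernel t x y / t powr (s/2 + 1)) * indicator {0<..} t) \<partial>lborel)"
      unfolding frac_kernel_def by (subst nn_integral_cmult) auto
    also have "\<dots> = (\<integral>\<^sup>+ t. ?m t x y * ?w t \<partial>lborel)"
    proof (rule nn_integral_cong)
      fix t :: real
      have "ennreal (gaussian_density x) * ennreal (gaussian_density y) *
          ennreal (mehler_kernel t x y / t powr (s/2 + 1)) =
          ennreal (mehler_density t x y) * ennreal (1 / t powr (s/2 + 1))"
        by (simp add: mehler_density_def mehler_kernel_nonneg gaussian_density_pos less_imp_le
            flip: ennreal_mult)
      then show "(ennreal (gaussian_density x) * ennreal (gaussian_density y) * indicator (A \<times> B) (x, y)) *
        (ennreal (mehler_kernel t x y / t powr (s/2 + 1)) * indicator {0<..} t) = ?m t x y * ?w t"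
        by (simp add: indicator_def)
    qed
    finally show ?thesis .
  qed
  have inner: "(\<integral>\<^sup>+ y\<in>B. frac_kernel s x y \<partial>gaussian_measure) =
      (\<integral>\<^sup>+ y. ennreal (gaussian_density y) * (frac_kernel s x y * indicator B y) \<partial>lborel)" for x
    by (rule nn_integral_gaussian_measure) measurable
  have "frac_interaction s A B =
      (\<integral>\<^sup>+ x. ennreal (gaussian_density x) * ((\<integral>\<^sup>+ y. ennreal (gaussian_density y) *
        (frac_kernel s x y * indicator B y) \<partial>lborel) * indicator A x) \<partial>lborel)"
    unfolding frac_interaction_def inner by (rule nn_integral_gaussian_measure) measurable
  also have "\<dots> = (\<integral>\<^sup>+ x. \<integral>\<^sup>+ y. ennreal (gaussian_density x) * (ennreal (gaussian_density y) *
        (frac_kernel s x y * indicator B y) * indicator A x) \<partial>lborel \<partial>lborel)"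
    by (rule nn_integral_cong, subst nn_integral_cmult, measurable, subst nn_integral_multc, measurable)
  also have "\<dots> = (\<integral>\<^sup>+ x. \<integral>\<^sup>+ y. \<integral>\<^sup>+ t. ?m t x y * ?w t \<partial>lborel \<partial>lborel \<partial>lborel)"
    unfolding k ..
  also have "\<dots> = (\<integral>\<^sup>+ x. \<integral>\<^sup>+ t. \<integral>\<^sup>+ y. ?m t x y * ?w t \<partial>lborel \<partial>lborel \<partial>lborel)"
    by (intro nn_integral_cong lborel_pair.Fubini') measurable
  also have "\<dots> = (\<integral>\<^sup>+ t. \<integral>\<^sup>+ x. \<integral>\<^sup>+ y. ?m t x y * ?w t \<partial>lborel \<partial>lborel \<partial>lborel)"
    by (rule lborel_pair.Fubini') measurable
  also have "\<dots> = (\<integral>\<^sup>+ t. mehler_overlap t A B * ?w t \<partial>lborel)"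
  proof (rule nn_integral_cong)
    fix t :: real
    have "(\<integral>\<^sup>+ x. \<integral>\<^sup>+ y. ?m t x y * ?w t \<partial>lborel \<partial>lborel)
        = (\<integral>\<^sup>+ x. (\<integral>\<^sup>+ y. ?m t x y \<partial>lborel) * ?w t \<partial>lborel)"
      by (intro nn_integral_cong nn_integral_multc) measurable
    also have "\<dots> = mehler_overlap t A B * ?w t"
      unfolding mehler_overlap_def by (intro nn_integral_multc) measurable
    finally show "(\<integral>\<^sup>+ x. \<integral>\<^sup>+ y. ?m t x y * ?w t \<partial>lborel \<partial>lborel) = mehler_overlap t A B * ?w t" .
  qed
  finally show ?thesis by (simp only: mult.assoc)
qed

section \<open>Decorrelation at large times\<close>

lemma exp_neg_tendsto_0: "((\<lambda>t. exp (- t)) \<longlongrightarrow> (0::real)) at_top"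
  by (rule filterlim_compose[OF exp_at_bot filterlim_uminus_at_bot_at_top])

lemma mehler_density_tendsto:
  "((\<lambda>t. mehler_density t x y) \<longlongrightarrow> gaussian_density x * gaussian_density y) at_top"
proof -
  have e2: "exp (- 2 * t) = exp (- t) * exp (- t)" for t :: real
    by (simp flip: exp_add)
  have "((\<lambda>t. mehler_kernel t x y) \<longlongrightarrow> 1) at_top"
    unfolding mehler_kernel_def e2
    by (rule tendsto_eq_intros exp_neg_tendsto_0 refl | simp)+
  from tendsto_mult_left[OF this, of "gaussian_density x * gaussian_density y"]
  show ?thesis by (simp add: mehler_density_def)
qed

lemma mehler_density_le:
  fixes x y :: "real ^ 'n"
  assumes "t \<ge> 1"
  shows "mehler_density t x y \<le> (2 * pi) powr (- real CARD('n)) *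
    (1 - exp (- 2)) powr (- (real CARD('n) / 2)) * exp (- (1/4) * (norm (x, y))\<^sup>2)"
proof -
  define r where "r = exp (- t)"
  have r: "0 < r" "r < 1" using assms by (auto simp: r_def)
  have combine: "a / 8 \<le> P \<Longrightarrow> b / 8 \<le> Q \<Longrightarrow> a + b = 2 * n \<Longrightarrow> m = n \<Longrightarrow> - (P + Q) \<le> - (1/4) * m"
    for a b P Q m n :: real by linarith
  have "(norm (x - y))\<^sup>2 / 8 \<le> (norm (x - y))\<^sup>2 / (4 * (1 - r))"
    using r by (intro divide_left_mono) auto
  moreover have "(norm (x + y))\<^sup>2 / 8 \<le> (norm (x + y))\<^sup>2 / (4 * (1 + r))"
    using r by (intro divide_left_mono) auto
  moreover have "(norm (x - y))\<^sup>2 + (norm (x + y))\<^sup>2 = 2 * ((norm x)\<^sup>2 + (norm y)\<^sup>2)"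
    unfolding power2_norm_eq_inner by (simp add: inner_commute algebra_simps)
  moreover have "(norm (x, y))\<^sup>2 = (norm x)\<^sup>2 + (norm y)\<^sup>2"
    by (simp add: norm_Pair)
  ultimately have e: "- ((norm (x - y))\<^sup>2 / (4 * (1 - r)) + (norm (x + y))\<^sup>2 / (4 * (1 + r)))
      \<le> - (1/4) * (norm (x, y))\<^sup>2"
    by (rule combine)
  have "(1 - exp (- 2 * t)) powr (- (real CARD('n) / 2)) \<le> (1 - exp (- 2)) powr (- (real CARD('n) / 2))"
    using assms by (intro powr_mono2') auto
  then show ?thesis
    using assms e unfolding r_def by (subst mehler_density_eq) (auto intro!: mult_mono)
qed

text \<open>The two Gaussian vectors decorrelate: the joint density tends to the product density, and for
  \<open>t \<ge> 1\<close> it is dominated by a multiple of \<open>exp (- \<bar>(x, y)\<bar>\<^sup>2 / 4)\<close>.\<close>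

lemma mehler_overlap_tendsto:
  fixes A B :: "(real ^ 'n) set"
  assumes [measurable]: "A \<in> sets borel" "B \<in> sets borel"
  shows "((\<lambda>t. mehler_overlap t A B) \<longlongrightarrow>
    emeasure gaussian_measure A * emeasure gaussian_measure B) at_top"
proof (rule tendsto_at_topI_sequentially)
  fix X :: "nat \<Rightarrow> real"
  assume X: "filterlim X at_top sequentially"
  define K :: real where "K = (2 * pi) powr (- real CARD('n)) * (1 - exp (- 2)) powr (- (real CARD('n) / 2))"
  have K: "0 \<le> K" by (simp add: K_def)
  let ?u = "\<lambda>t (p :: (real ^ 'n) \<times> (real ^ 'n)).
    ennreal (mehler_density t (fst p) (snd p)) * indicator (A \<times> B) p"
  let ?v = "\<lambda>(p :: (real ^ 'n) \<times> (real ^ 'n)).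
    ennreal (gaussian_density (fst p) * gaussian_density (snd p)) * indicator (A \<times> B) p"
  have "\<forall>\<^sub>F n in sequentially. X n \<ge> 1"
    using X by (simp add: filterlim_at_top)
  \<comment> \<open>The domination holds only for times at least \<open>1\<close>, so the sequence is shifted by \<open>N\<close>.\<close>
  then obtain N where N: "\<And>n. n \<ge> N \<Longrightarrow> X n \<ge> 1"
    by (auto simp: eventually_sequentially)
  have "?u t \<in> borel_measurable (lborel \<Otimes>\<^sub>M lborel)" for t by measurable
  then have um: "?u t \<in> borel_measurable lborel" for t by (simp only: lborel_prod)
  have vm': "?v \<in> borel_measurable (lborel \<Otimes>\<^sub>M lborel)" by measurable
  then have vm: "?v \<in> borel_measurable lborel" by (simp only: lborel_prod)
  have "(\<lambda>n. \<integral>\<^sup>+ p. ?u (X (n + N)) p \<partial>lborel) \<longlonglongrightarrow> (\<integral>\<^sup>+ p. ?v p \<partial>lborel)"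
  proof (rule nn_integral_dominated_convergence[where w = "\<lambda>p. ennreal (K * exp (- (1/4) * (norm p)\<^sup>2))"])
    show "AE p in lborel. ?u (X (n + N)) p \<le> ennreal (K * exp (- (1/4) * (norm p)\<^sup>2))" for n
    proof (rule AE_I2)
      fix p :: "(real ^ 'n) \<times> (real ^ 'n)"
      have "?u (X (n + N)) p \<le> ennreal (mehler_density (X (n + N)) (fst p) (snd p))"
        by (auto simp: indicator_def)
      also have "\<dots> \<le> ennreal (K * exp (- (1/4) * (norm p)\<^sup>2))"
        using mehler_density_le[of "X (n + N)" "fst p" "snd p"] N[of "n + N"]
        by (intro ennreal_leI) (simp add: K_def)
      finally show "?u (X (n + N)) p \<le> ennreal (K * exp (- (1/4) * (norm p)\<^sup>2))" .
    qed
    have "(\<integral>\<^sup>+ p. ennreal (K * exp (- (1/4) * (norm (p :: (real ^ 'n) \<times> (real ^ 'n)))\<^sup>2)) \<partial>lborel)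
        = ennreal K * (\<integral>\<^sup>+ p. ennreal (exp (- (1/4) * (norm (p :: (real ^ 'n) \<times> (real ^ 'n)))\<^sup>2)) \<partial>lborel)"
      using K by (subst nn_integral_cmult[symmetric]) (auto simp: ennreal_mult)
    also have "\<dots> < \<infinity>"
      using nn_integral_exp_neg_norm_sq_finite[of "1/4", where 'a = "(real ^ 'n) \<times> (real ^ 'n)"]
      by (simp add: ennreal_mult_less_top)
    finally show "(\<integral>\<^sup>+ p. ennreal (K * exp (- (1/4) * (norm (p :: (real ^ 'n) \<times> (real ^ 'n)))\<^sup>2)) \<partial>lborel) < \<infinity>" .
    show "AE p in lborel. (\<lambda>n. ?u (X (n + N)) p) \<longlonglongrightarrow> ?v p"
    proof (rule AE_I2)
      fix p :: "(real ^ 'n) \<times> (real ^ 'n)"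
      have "(\<lambda>n. mehler_density (X n) (fst p) (snd p))
          \<longlonglongrightarrow> gaussian_density (fst p) * gaussian_density (snd p)"
        by (rule filterlim_compose[OF mehler_density_tendsto X])
      then have "(\<lambda>n. ennreal (mehler_density (X (n + N)) (fst p) (snd p)))
          \<longlonglongrightarrow> ennreal (gaussian_density (fst p) * gaussian_density (snd p))"
        by (intro tendsto_ennrealI LIMSEQ_ignore_initial_segment)
      then show "(\<lambda>n. ?u (X (n + N)) p) \<longlonglongrightarrow> ?v p"
        by (cases "p \<in> A \<times> B") simp_all
    qed
  qed (use um vm in auto)
  also have "(\<lambda>n. \<integral>\<^sup>+ p. ?u (X (n + N)) p \<partial>lborel) = (\<lambda>n. mehler_overlap (X (n + N)) A B)"
    by (simp add: mehler_overlap_eq)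
  also have "(\<integral>\<^sup>+ p. ?v p \<partial>lborel) = (\<integral>\<^sup>+ x. \<integral>\<^sup>+ y. ?v (x, y) \<partial>lborel \<partial>lborel)"
    using lborel.nn_integral_fst[OF vm'] by (simp add: lborel_prod)
  also have "\<dots> = (\<integral>\<^sup>+ x. (\<integral>\<^sup>+ y. (ennreal (gaussian_density x) * indicator A x) *
      (ennreal (gaussian_density y) * indicator B y) \<partial>lborel) \<partial>lborel)"
    by (intro nn_integral_cong)
      (simp add: indicator_times ennreal_mult gaussian_density_pos less_imp_le mult_ac)
  also have "\<dots> = (\<integral>\<^sup>+ x. (ennreal (gaussian_density x) * indicator A x) * emeasure gaussian_measure B \<partial>lborel)"
    unfolding emeasure_gaussian_measure[OF assms(2)]
    by (intro nn_integral_cong nn_integral_cmult) measurable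
  also have "\<dots> = emeasure gaussian_measure A * emeasure gaussian_measure B"
    unfolding emeasure_gaussian_measure[OF assms(1)] by (intro nn_integral_multc) measurable
  finally show "(\<lambda>n. mehler_overlap (X n) A B) \<longlonglongrightarrow> emeasure gaussian_measure A * emeasure gaussian_measure B"
    by (rule LIMSEQ_offset)
qed

section \<open>Crossing a sphere in short time\<close>

lemma nn_integral_lborel_affine:
  fixes f :: "'a::euclidean_space \<Rightarrow> ennreal"
  assumes [measurable]: "f \<in> borel_measurable borel" and "c \<noteq> 0"
  shows "(\<integral>\<^sup>+ y. f y \<partial>lborel) = (\<integral>\<^sup>+ w. ennreal (\<bar>c\<bar> ^ DIM('a)) * f (x + c *\<^sub>R w) \<partial>lborel)"
  by (subst lborel_affine[OF \<open>c \<noteq> 0\<close>, of x])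
     (simp add: nn_integral_density nn_integral_distr)

text \<open>A point of the ball that leaves it under translation by \<open>z\<close> lies within \<open>\<bar>z\<bar>\<close> of the sphere, and
  Bernoulli's inequality bounds the volume of this shell linearly in \<open>\<bar>z\<bar>\<close>.\<close>

lemma emeasure_ball_diff_translate_le:
  fixes p z :: "'a::euclidean_space"
  shows "emeasure lborel {x \<in> ball p 1. x + z \<notin> ball p 1}
    \<le> ennreal (unit_ball_vol DIM('a) * DIM('a) * norm z)"
proof (cases "norm z \<le> 1")
  case True
  define V where "V = unit_ball_vol (real DIM('a))"
  have V: "0 \<le> V" by (simp add: V_def less_imp_le)
  have sub: "{x \<in> ball p 1. x + z \<notin> ball p 1} \<subseteq> ball p 1 - ball p (1 - norm z)"
  proof -
    have "dist p (x + z) \<le> dist p x + norm z" for x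
      using dist_triangle[of p "x + z" x] by (simp add: dist_norm)
    then have "\<not> dist p x < 1 - norm z" if "\<not> dist p (x + z) < 1" for x
      using that by (metis add_less_cancel_right diff_add_cancel le_less_trans)
    then show ?thesis by auto
  qed
  have "emeasure lborel {x \<in> ball p 1. x + z \<notin> ball p 1} \<le> emeasure lborel (ball p 1 - ball p (1 - norm z))"
    by (intro emeasure_mono sub) auto
  also have "\<dots> = emeasure lborel (ball p 1) - emeasure lborel (ball p (1 - norm z))"
    using True by (intro emeasure_Diff subset_ball) (auto simp: emeasure_ball)
  also have "\<dots> = ennreal (V - V * (1 - norm z) ^ DIM('a))"
    using True V by (simp add: emeasure_ball V_def[symmetric] ennreal_minus)
  also have "\<dots> \<le> ennreal (V * DIM('a) * norm z)"
  proof (rule ennreal_leI)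
    have "1 + real DIM('a) * (- norm z) \<le> (1 + (- norm z)) ^ DIM('a)"
      using True by (intro Bernoulli_inequality) simp
    then have "V * (1 - (1 - norm z) ^ DIM('a)) \<le> V * (DIM('a) * norm z)"
      using V by (intro mult_left_mono) auto
    then show "V - V * (1 - norm z) ^ DIM('a) \<le> V * DIM('a) * norm z"
      by (simp add: algebra_simps)
  qed
  finally show ?thesis by (simp add: V_def)
next
  case False
  have "emeasure lborel {x \<in> ball p 1. x + z \<notin> ball p 1} \<le> emeasure lborel (ball p 1)"
    by (intro emeasure_mono) auto
  also have "\<dots> = ennreal (unit_ball_vol DIM('a) * 1)" by (simp add: emeasure_ball)
  also have "\<dots> \<le> ennreal (unit_ball_vol DIM('a) * (DIM('a) * norm z))"
  proof (intro ennreal_leI mult_left_mono)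
    have "1 * 1 \<le> real DIM('a) * norm z"
      using False DIM_positive[where 'a = 'a] by (intro mult_mono) (auto simp: Suc_le_eq)
    then show "1 \<le> real DIM('a) * norm z" by simp
  qed (simp add: less_imp_le)
  finally show ?thesis by (simp add: mult.assoc)
qed

text \<open>Only the crossing of the sphere contributes for small \<open>t\<close>. With \<open>h = sqrt (1 - exp (- t))\<close> and
  \<open>y = x + h w\<close>, the density is at most a constant times \<open>exp (- \<bar>w\<bar>\<^sup>2 / 4)\<close> in \<open>w\<close>, and for
  fixed \<open>w\<close> the admissible \<open>x\<close> lie in a shell of volume at most a constant times \<open>h \<bar>w\<bar>\<close>.
  Integrating over \<open>w\<close> leaves a multiple of \<open>h\<close>.\<close>

lemma mehler_overlap_ball_le:
  fixes p :: "real ^ 'n"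
  obtains C where "C \<ge> 0"
    and "\<And>t. t > 0 \<Longrightarrow> mehler_overlap t (ball p 1) (- ball p 1) \<le> ennreal (C * sqrt (1 - exp (- t)))"
proof -
  define c where "c = (2 * pi) powr (- real CARD('n))"
  define V where "V = unit_ball_vol (real CARD('n)) * real CARD('n)"
  define G where "G = (\<integral>\<^sup>+ w. ennreal (exp (- (1/8) * (norm (w :: real ^ 'n))\<^sup>2)) \<partial>lborel)"
  have c: "0 \<le> c" and V: "0 \<le> V" by (simp_all add: c_def V_def less_imp_le)
  have G: "G < \<infinity>" unfolding G_def by (rule nn_integral_exp_neg_norm_sq_finite) simp
  let ?U = "ball p 1"
  have [measurable]: "?U \<in> sets borel" by simp
  have "mehler_overlap t ?U (- ?U) \<le> ennreal (2 * c * V * enn2real G * sqrt (1 - exp (- t)))"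
    if t: "t > 0" for t
  proof -
    define h where "h = sqrt (1 - exp (- t))"
    have h: "0 < h" "h\<^sup>2 = 1 - exp (- t)" using t by (auto simp: h_def)
    \<comment> \<open>The normalising factor at scale \<open>h\<close>; the Jacobian of \<open>y = x + h w\<close> cancels it.\<close>
    have pre: "(1 - exp (- 2 * t)) powr (- (real CARD('n) / 2)) \<le> 1 / h ^ CARD('n)"
    proof -
      have "(1 - exp (- 2 * t)) powr (- (real CARD('n) / 2)) \<le> (h\<^sup>2) powr (- (real CARD('n) / 2))"
        using t h by (intro powr_mono2') auto
      also have "\<dots> = 1 / h ^ CARD('n)"
        using h(1) by (simp add: powr_powr powr_minus_divide powr_realpow flip: powr_numeral)
      finally show ?thesis .
    qed
    have dens: "mehler_density t x y \<le> c * (1 / h ^ CARD('n)) * exp (- ((norm (y - x))\<^sup>2 / (4 * h\<^sup>2)))" for x y :: "real ^ 'n"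
    proof -
      have "0 \<le> (norm (x + y))\<^sup>2 / (4 * (1 + exp (- t)))"
        by (intro divide_nonneg_pos) (auto simp: add_pos_pos)
      then have "- ((norm (x - y))\<^sup>2 / (4 * (1 - exp (- t))) + (norm (x + y))\<^sup>2 / (4 * (1 + exp (- t))))
          \<le> - ((norm (y - x))\<^sup>2 / (4 * h\<^sup>2))"
        unfolding h(2) by (simp add: norm_minus_commute)
      then show ?thesis
        using pre c h unfolding mehler_density_eq[OF t] c_def by (intro mult_mono) auto
    qed
    have slice: "(\<integral>\<^sup>+ y. ennreal (mehler_density t x y) * indicator (?U \<times> - ?U) (x, y) \<partial>lborel)
        \<le> (\<integral>\<^sup>+ w. ennreal (c * exp (- (1/4) * (norm w)\<^sup>2)) *
            indicator {x \<in> ?U. x + h *\<^sub>R w \<notin> ?U} x \<partial>lborel)" for x :: "real ^ 'n"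
    proof -
      have "(\<integral>\<^sup>+ y. ennreal (mehler_density t x y) * indicator (?U \<times> - ?U) (x, y) \<partial>lborel)
          = (\<integral>\<^sup>+ w. ennreal (\<bar>h\<bar> ^ DIM(real ^ 'n)) * (ennreal (mehler_density t x (x + h *\<^sub>R w)) *
              indicator (?U \<times> - ?U) (x, x + h *\<^sub>R w)) \<partial>lborel)"
        using h(1) by (intro nn_integral_lborel_affine) measurable
      also have "\<dots> \<le> (\<integral>\<^sup>+ w. ennreal (c * exp (- (1/4) * (norm w)\<^sup>2)) *
            indicator {x \<in> ?U. x + h *\<^sub>R w \<notin> ?U} x \<partial>lborel)"
      proof (rule nn_integral_mono)
        fix w :: "real ^ 'n"
        have "h ^ CARD('n) * mehler_density t x (x + h *\<^sub>R w)
            \<le> h ^ CARD('n) * (c * (1 / h ^ CARD('n)) * exp (- ((norm (x + h *\<^sub>R w - x))\<^sup>2 / (4 * h\<^sup>2))))"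
          using h by (intro mult_left_mono dens) auto
        also have "\<dots> = c * exp (- (1/4) * (norm w)\<^sup>2)"
          using h(1) by (simp add: power_mult_distrib)
        finally have "ennreal (\<bar>h\<bar> ^ DIM(real ^ 'n)) * ennreal (mehler_density t x (x + h *\<^sub>R w))
            \<le> ennreal (c * exp (- (1/4) * (norm w)\<^sup>2))"
          using h(1) by (simp add: mehler_density_nonneg ennreal_leI flip: ennreal_mult)
        then show "ennreal (\<bar>h\<bar> ^ DIM(real ^ 'n)) * (ennreal (mehler_density t x (x + h *\<^sub>R w)) *
              indicator (?U \<times> - ?U) (x, x + h *\<^sub>R w))
            \<le> ennreal (c * exp (- (1/4) * (norm w)\<^sup>2)) * indicator {x \<in> ?U. x + h *\<^sub>R w \<notin> ?U} x"
          by (auto simp: indicator_def)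
      qed
      finally show ?thesis .
    qed
    have "mehler_overlap t ?U (- ?U) \<le> (\<integral>\<^sup>+ x. \<integral>\<^sup>+ w. ennreal (c * exp (- (1/4) * (norm w)\<^sup>2)) *
            indicator {x \<in> ?U. x + h *\<^sub>R w \<notin> ?U} x \<partial>lborel \<partial>lborel)"
      unfolding mehler_overlap_def by (intro nn_integral_mono slice)
    also have "\<dots> = (\<integral>\<^sup>+ w. \<integral>\<^sup>+ x. ennreal (c * exp (- (1/4) * (norm w)\<^sup>2)) *
            indicator {x \<in> ?U. x + h *\<^sub>R w \<notin> ?U} x \<partial>lborel \<partial>lborel)"
      by (rule lborel_pair.Fubini'[symmetric]) measurable
    also have "\<dots> = (\<integral>\<^sup>+ w. ennreal (c * exp (- (1/4) * (norm w)\<^sup>2)) *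
            emeasure lborel {x \<in> ?U. x + h *\<^sub>R w \<notin> ?U} \<partial>lborel)"
      by (intro nn_integral_cong nn_integral_cmult_indicator) measurable
    also have "\<dots> \<le> (\<integral>\<^sup>+ w. ennreal (2 * c * V * h) *
            ennreal (exp (- (1/8) * (norm (w :: real ^ 'n))\<^sup>2)) \<partial>lborel)"
    proof (rule nn_integral_mono)
      fix w :: "real ^ 'n"
      \<comment> \<open>Half of the Gaussian exponent absorbs the linear factor \<open>norm w\<close>.\<close>
      have "norm w \<le> 2 * exp ((1/8) * (norm w)\<^sup>2)"
      proof -
        have "0 \<le> (norm w / 2 - 1)\<^sup>2" by simp
        then have "norm w \<le> 2 * (1 + (1/8) * (norm w)\<^sup>2)"
          by (simp add: power2_eq_square algebra_simps)
        also have "\<dots> \<le> 2 * exp ((1/8) * (norm w)\<^sup>2)"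
          using exp_ge_add_one_self by (intro mult_left_mono) auto
        finally show ?thesis .
      qed
      then have "exp (- (1/4) * (norm w)\<^sup>2) * norm w \<le> exp (- (1/4) * (norm w)\<^sup>2) * (2 * exp ((1/8) * (norm w)\<^sup>2))"
        by (intro mult_left_mono) auto
      also have "\<dots> = 2 * exp (- (1/8) * (norm w)\<^sup>2)"
        by (simp flip: exp_add)
      finally have "(c * V * h) * (exp (- (1/4) * (norm w)\<^sup>2) * norm w) \<le> (c * V * h) * (2 * exp (- (1/8) * (norm w)\<^sup>2))"
        using c V h(1) by (intro mult_left_mono) auto
      then have real: "c * exp (- (1/4) * (norm w)\<^sup>2) * (V * norm (h *\<^sub>R w)) \<le> 2 * c * V * h * exp (- (1/8) * (norm w)\<^sup>2)"
        using h(1) by (simp add: mult_ac)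
      have "emeasure lborel {x \<in> ?U. x + h *\<^sub>R w \<notin> ?U} \<le> ennreal (V * norm (h *\<^sub>R w))"
        using emeasure_ball_diff_translate_le[of p "h *\<^sub>R w"] by (simp add: V_def)
      then have "ennreal (c * exp (- (1/4) * (norm w)\<^sup>2)) * emeasure lborel {x \<in> ?U. x + h *\<^sub>R w \<notin> ?U}
          \<le> ennreal (c * exp (- (1/4) * (norm w)\<^sup>2)) * ennreal (V * norm (h *\<^sub>R w))"
        by (intro mult_left_mono) auto
      also have "\<dots> \<le> ennreal (2 * c * V * h) * ennreal (exp (- (1/8) * (norm w)\<^sup>2))"
        using real c V h(1) by (simp add: ennreal_leI flip: ennreal_mult)
      finally show "ennreal (c * exp (- (1/4) * (norm w)\<^sup>2)) * emeasure lborel {x \<in> ?U. x + h *\<^sub>R w \<notin> ?U}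
          \<le> ennreal (2 * c * V * h) * ennreal (exp (- (1/8) * (norm w)\<^sup>2))" .
    qed
    also have "\<dots> = ennreal (2 * c * V * h) * G"
      unfolding G_def by (intro nn_integral_cmult) measurable
    also have "\<dots> = ennreal (2 * c * V * h) * ennreal (enn2real G)"
      using G by simp
    also have "\<dots> = ennreal (2 * c * V * enn2real G * h)"
      using c V h(1) by (simp add: mult_ac flip: ennreal_mult)
    finally show ?thesis by (simp add: h_def)
  qed
  moreover have "0 \<le> 2 * c * V * enn2real G" using c V by simp
  ultimately show ?thesis using that by blast
qed

section \<open>Interactions and perimeters of a ball\<close>

text \<open>The sphere bound makes the overlap \<open>O(min(1, sqrt t))\<close>, which is what the power-weighted
  integral requires; its limit \<open>\<gamma>(A) \<gamma>(B)\<close> at infinity then gives the limit of the interactions.\<close>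

lemma frac_interaction_across_sphere:
  fixes A B :: "(real ^ 'n) set"
  assumes [measurable]: "A \<in> sets borel" "B \<in> sets borel"
    and sub: "A \<subseteq> ball p 1" "B \<subseteq> - ball p 1"
  shows "0 < s \<Longrightarrow> s < 1 \<Longrightarrow> frac_interaction s A B < \<infinity>"
    and "((\<lambda>s. ennreal s * frac_interaction s A B) \<longlongrightarrow>
      2 * (emeasure gaussian_measure A * emeasure gaussian_measure B)) (at_right 0)"
proof -
  obtain C where C: "C \<ge> 0"
    and ball: "\<And>t. t > 0 \<Longrightarrow> mehler_overlap t (ball p 1) (- ball p 1) \<le> ennreal (C * sqrt (1 - exp (- t)))"
    using mehler_overlap_ball_le[of p] by blast
  have le: "mehler_overlap t A B \<le> ennreal (C * sqrt (1 - exp (- t)))" if "t > 0" for t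
  proof -
    have "mehler_overlap t A B \<le> mehler_overlap t (ball p 1) (- ball p 1)"
      unfolding mehler_overlap_def using sub
      by (intro nn_integral_mono mult_left_mono) (auto simp: indicator_def)
    with ball[OF that] show ?thesis by (rule order.trans[rotated])
  qed
  have le1: "C * sqrt (1 - exp (- t)) \<le> C" for t
    using mult_left_mono[OF _ C, of "sqrt (1 - exp (- t))" 1] by simp
  define h where "h t = enn2real (mehler_overlap t A B)" for t
  define M where "M = emeasure gaussian_measure A * emeasure gaussian_measure B"
  define L where "L = enn2real M"
  have [measurable]: "h \<in> borel_measurable borel" unfolding h_def by measurable
  have h0: "0 \<le> h t" for t by (simp add: h_def)
  have h: "mehler_overlap t A B = ennreal (h t)" "h t \<le> C * sqrt (1 - exp (- t))" if "t > 0" for t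
  proof -
    have "mehler_overlap t A B < top" using le[OF that] ennreal_less_top by (rule le_less_trans)
    then show eq: "mehler_overlap t A B = ennreal (h t)" by (simp add: h_def)
    have "0 \<le> C * sqrt (1 - exp (- t))" using C that by simp
    then show "h t \<le> C * sqrt (1 - exp (- t))" using le[OF that] by (simp add: eq)
  qed
  have hC: "h t \<le> C" if "t > 0" for t
    using h(2)[OF that] le1[of t] by linarith
  have hsqrt: "h t \<le> C * sqrt t" if "t > 0" for t
  proof -
    have "1 - exp (- t) \<le> t" using exp_ge_add_one_self[of "- t"] by linarith
    then have "C * sqrt (1 - exp (- t)) \<le> C * sqrt t"
      using C by (intro mult_left_mono) auto
    with h(2)[OF that] show ?thesis by linarith
  qed
  have limM: "((\<lambda>t. mehler_overlap t A B) \<longlongrightarrow> M) at_top"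
    unfolding M_def by (rule mehler_overlap_tendsto) auto
  have "M \<le> ennreal C"
  proof (rule tendsto_upperbound[OF limM])
    show "\<forall>\<^sub>F t in at_top. mehler_overlap t A B \<le> ennreal C"
      using eventually_gt_at_top[of 0] by eventually_elim (use h(1) hC in \<open>simp add: ennreal_leI\<close>)
  qed simp
  then have M: "M = ennreal L" "0 \<le> L"
    unfolding L_def using le_less_trans[OF _ ennreal_less_top] by auto
  have lim: "(h \<longlongrightarrow> L) at_top"
    using limM unfolding h_def M(1) by (rule tendsto_enn2real[OF _ M(2)])
  have int: "integrable lborel (\<lambda>t. indicator {0<..} t * (h t / t powr (s/2 + 1)))" if "0 < s" "s < 1" for s
    by (rule power_weighted_integral_near_zero(1)[OF _ h0 hC hsqrt lim that]) auto
  have eq: "frac_interaction s A B = ennreal (\<integral>t. indicator {0<..} t * (h t / t powr (s/2 + 1)) \<partial>lborel)"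
    if "0 < s" "s < 1" for s
  proof -
    have "frac_interaction s A B = (\<integral>\<^sup>+ t. ennreal (indicator {0<..} t * (h t / t powr (s/2 + 1))) \<partial>lborel)"
      unfolding frac_interaction_eq[OF assms(1,2)]
      by (intro nn_integral_cong) (auto simp: indicator_def h(1) h0 simp flip: ennreal_mult)
    also have "\<dots> = ennreal (\<integral>t. indicator {0<..} t * (h t / t powr (s/2 + 1)) \<partial>lborel)"
      using h0 by (intro nn_integral_eq_integral int that) auto
    finally show ?thesis .
  qed
  show "frac_interaction s A B < \<infinity>" if "0 < s" "s < 1" for s
    using eq[OF that] by simp
  have "((\<lambda>s. s * (\<integral>t. indicator {0<..} t * (h t / t powr (s/2 + 1)) \<partial>lborel)) \<longlongrightarrow> 2 * L) (at_right 0)"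
    by (rule power_weighted_integral_near_zero(2)[OF _ h0 hC hsqrt lim]) auto
  then have "((\<lambda>s. ennreal (s * (\<integral>t. indicator {0<..} t * (h t / t powr (s/2 + 1)) \<partial>lborel))) \<longlongrightarrow> 2 * M)
      (at_right 0)"
    using tendsto_ennrealI M by (fastforce simp: ennreal_mult)
  then have "((\<lambda>s. ennreal s * frac_interaction s A B) \<longlongrightarrow> 2 * M) (at_right 0)"
  proof (rule Lim_transform_eventually)
    have "\<forall>\<^sub>F s in at_right 0. s \<in> {0<..<1::real}"
      by (rule eventually_at_right_real) simp
    then show "\<forall>\<^sub>F s in at_right 0. ennreal (s * (\<integral>t. indicator {0<..} t * (h t / t powr (s/2 + 1)) \<partial>lborel))
        = ennreal s * frac_interaction s A B"
      by eventually_elim (simp add: eq ennreal_mult')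
  qed
  then show "((\<lambda>s. ennreal s * frac_interaction s A B) \<longlongrightarrow>
      2 * (emeasure gaussian_measure A * emeasure gaussian_measure B)) (at_right 0)"
    unfolding M_def .
qed

lemma frac_interaction_commute:
  assumes "A \<in> sets borel" "B \<in> sets borel"
  shows "frac_interaction s A B = frac_interaction s B A"
  using assms by (simp add: frac_interaction_eq mehler_overlap_commute[of A B])

lemma frac_perimeter_Compl:
  assumes [measurable]: "E \<in> sets borel" "\<Omega> \<in> sets borel"
  shows "frac_perimeter s (- E) \<Omega> = frac_perimeter s E \<Omega>"
proof -
  have c: "frac_interaction s (- E \<inter> X) (E \<inter> Y) = frac_interaction s (E \<inter> Y) (- E \<inter> X)"
    if "X \<in> sets borel" "Y \<in> sets borel" for X Y
    using that by (intro frac_interaction_commute) auto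
  show ?thesis
    using c[of \<Omega> \<Omega>] c[of \<Omega> "- \<Omega>"] c[of "- \<Omega>" \<Omega>] by (simp add: frac_perimeter_def add_ac)
qed

lemma frac_perimeter_UNIV: "frac_perimeter s UNIV \<Omega> = 0"
  by (simp add: frac_perimeter_def frac_interaction_def)

text \<open>Each of the three interactions in the perimeter pairs a part of the ball with a part of its
  complement, so all of them are covered by the estimate across the sphere. The three limits
  add up to \<open>\<mu>(U)\<close>.\<close>

lemma frac_perimeter_ball:
  fixes \<Omega> :: "(real ^ 'n) set" and p :: "real ^ 'n"
  assumes [measurable]: "\<Omega> \<in> sets borel"
  defines "U \<equiv> ball p 1"
  shows "0 < s \<Longrightarrow> s < 1 \<Longrightarrow> frac_perimeter s U \<Omega> < \<infinity>"
    and "limit_perimeter \<Omega> U =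
      2 * (emeasure gaussian_measure (U \<inter> \<Omega>) * emeasure gaussian_measure (- U \<inter> \<Omega>)) +
      2 * (emeasure gaussian_measure (U \<inter> \<Omega>) * emeasure gaussian_measure (- U \<inter> - \<Omega>)) +
      2 * (emeasure gaussian_measure (U \<inter> - \<Omega>) * emeasure gaussian_measure (- U \<inter> \<Omega>))"
proof -
  have [measurable]: "U \<in> sets borel" by (simp add: U_def)
  have fin: "frac_interaction s (U \<inter> X) (- U \<inter> Y) < \<infinity>" if "X \<in> sets borel" "Y \<in> sets borel" "0 < s" "s < 1" for X Y s
    using that by (intro frac_interaction_across_sphere(1)[of _ _ p]) (auto simp: U_def)
  have lim: "((\<lambda>s. ennreal s * frac_interaction s (U \<inter> X) (- U \<inter> Y)) \<longlongrightarrow>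
      2 * (emeasure gaussian_measure (U \<inter> X) * emeasure gaussian_measure (- U \<inter> Y))) (at_right 0)"
    if "X \<in> sets borel" "Y \<in> sets borel" for X Y
    using that by (intro frac_interaction_across_sphere(2)[of _ _ p]) (auto simp: U_def)
  show "0 < s \<Longrightarrow> s < 1 \<Longrightarrow> frac_perimeter s U \<Omega> < \<infinity>"
    using fin[of \<Omega> \<Omega> s] fin[of \<Omega> "- \<Omega>" s] fin[of "- \<Omega>" \<Omega> s] by (simp add: frac_perimeter_def)
  show "limit_perimeter \<Omega> U =
      2 * (emeasure gaussian_measure (U \<inter> \<Omega>) * emeasure gaussian_measure (- U \<inter> \<Omega>)) +
      2 * (emeasure gaussian_measure (U \<inter> \<Omega>) * emeasure gaussian_measure (- U \<inter> - \<Omega>)) +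
      2 * (emeasure gaussian_measure (U \<inter> - \<Omega>) * emeasure gaussian_measure (- U \<inter> \<Omega>))"
    unfolding limit_perimeter_def frac_perimeter_def distrib_left
    by (intro tendsto_Lim tendsto_add lim) auto
qed

section \<open>Failure of additivity\<close>

lemma gaussian_measure_open_pos:
  fixes S :: "(real ^ 'n) set"
  assumes "open S" "S \<noteq> {}"
  shows "emeasure gaussian_measure S \<noteq> 0"
proof -
  have "S \<notin> null_sets lebesgue"
    using open_not_negligible[OF assms] by (simp add: negligible_iff_null_sets)
  then have "emeasure lborel S \<noteq> 0"
    using assms by (auto simp: null_sets_def)
  then show ?thesis
    using assms by (simp add: emeasure_gaussian_measure_eq_0_iff)
qed

theorem mainTheorem3:
  fixes \<Omega> :: "(real ^ 'n) set"
  assumes "\<Omega> \<noteq> {}" "open \<Omega>" "connected \<Omega>" "lipschitz_boundary \<Omega>"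
  shows "\<exists>A B. A \<in> finite_perimeter_sets \<Omega> \<and> B \<in> finite_perimeter_sets \<Omega> \<and>
           A \<inter> B = {} \<and> A \<union> B \<in> finite_perimeter_sets \<Omega> \<and>
           limit_perimeter \<Omega> (A \<union> B) \<noteq> limit_perimeter \<Omega> A + limit_perimeter \<Omega> B"
proof -
  let ?\<gamma> = "emeasure gaussian_measure"
  have \<Omega> [measurable]: "\<Omega> \<in> sets borel" using assms(2) by simp
  obtain p where p: "p \<in> \<Omega>" using assms(1) by blast
  define U where "U = ball p 1"
  have U [measurable]: "U \<in> sets borel" by (simp add: U_def)
  have mem: "E \<in> finite_perimeter_sets \<Omega>" if "E \<in> sets borel" "frac_perimeter (1/2) E \<Omega> < \<infinity>" for E
    unfolding finite_perimeter_sets_def using that by (auto intro!: exI[of _ "1/2"])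
  have fin: "frac_perimeter (1/2) U \<Omega> < \<infinity>"
    unfolding U_def by (rule frac_perimeter_ball(1)[OF \<Omega>]) auto
  have inside: "?\<gamma> (U \<inter> \<Omega>) \<noteq> 0"
  proof (rule gaussian_measure_open_pos)
    show "open (U \<inter> \<Omega>)" using assms(2) by (auto simp: U_def)
    have "p \<in> U \<inter> \<Omega>" using p by (simp add: U_def)
    then show "U \<inter> \<Omega> \<noteq> {}" by blast
  qed
  have outside: "?\<gamma> (- U \<inter> \<Omega>) \<noteq> 0 \<or> ?\<gamma> (- U \<inter> - \<Omega>) \<noteq> 0"
  proof -
    have "- cball p 1 \<noteq> {}"
      using compact_cball[of p 1] not_compact_UNIV by (metis Compl_empty_eq double_compl)
    then have "?\<gamma> (- cball p 1) \<noteq> 0"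
      by (intro gaussian_measure_open_pos) auto
    moreover have "?\<gamma> (- cball p 1) \<le> ?\<gamma> ((- U \<inter> \<Omega>) \<union> (- U \<inter> - \<Omega>))"
      using U \<Omega> by (intro emeasure_mono) (auto simp: U_def gaussian_measure_def)
    moreover have "?\<gamma> ((- U \<inter> \<Omega>) \<union> (- U \<inter> - \<Omega>)) \<le> ?\<gamma> (- U \<inter> \<Omega>) + ?\<gamma> (- U \<inter> - \<Omega>)"
      using U \<Omega> by (intro emeasure_subadditive) (auto simp: gaussian_measure_def)
    ultimately show ?thesis by (metis add_0 le_zero_eq)
  qed
  have pos: "limit_perimeter \<Omega> U \<noteq> 0"
    using inside outside unfolding U_def frac_perimeter_ball(2)[OF \<Omega>] by auto
  have zero: "limit_perimeter \<Omega> UNIV = 0"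
    unfolding limit_perimeter_def frac_perimeter_UNIV by (intro tendsto_Lim) auto
  show ?thesis
  proof (rule exI[of _ U], rule exI[of _ "- U"], intro conjI)
    show "U \<in> finite_perimeter_sets \<Omega>" "- U \<in> finite_perimeter_sets \<Omega>"
      "U \<union> - U \<in> finite_perimeter_sets \<Omega>"
      using fin by (auto intro!: mem simp: frac_perimeter_Compl frac_perimeter_UNIV)
    show "limit_perimeter \<Omega> (U \<union> - U) \<noteq> limit_perimeter \<Omega> U + limit_perimeter \<Omega> (- U)"
      using pos zero by simp
  qed auto
qed

end
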